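(* Let $U,V$ be any monomials in the variables $x_1,x_2,\ldots$. Then $$\mathfrak{S}_U\,\mathfrak{S}_V=\mathfrak{S}_{UV}+\sum_{|W|=|UV|,\ W<UV}c^{W}_{U,V}\,\mathfrak{S}_W,$$ where the sum is over monomials $W$, and for $W<UV$ with $|W|=|UV|$ the coefficients satisfy $$c^{W}_{U,V}=c_W(\mathfrak{S}_U\mathfrak{S}_V)-\sum_{Z:\ W<Z\le UV}c^{Z}_{U,V}\,c_W(\mathfrak{S}_Z),$$ the last sum being over monomials $Z$.
   Context: $S_n$ is generated by $s_1,\ldots,s_{n-1}$, $s_i=(i,i+1)$. $s_if$ is the result of interchanging $x_i,x_{i+1}$ in the polynomial $f$, $\partial_i(f)=\frac{f-s_if}{x_i-x_{i+1}}$; for $u\in S_n$ with reduced word $s_{a_1}\cdots s_{a_p}$, $\partial_u=\partial_{a_1}\cdots\partial_{a_p}$ (independent of the reduced word). $\mathfrak{S}_{w_0^n}=x_1^{n-1}x_2^{n-2}\cdots x_{n-1}$; the polynomials $\partial_u\mathfrak{S}_{w_0^n}$, $u\in S_n$, $n\ge 2$, are the Schubert polynomials ($\partial_u\mathfrak{S}_{w_0^n}$ being that of $w_0^nu^{-1}$, $w_0^n$ the longest element of $S_n$). Monomial order: for monomials $U=\prod_ix_i^{k_i}$, $V=\prod_ix_i^{l_i}$ (take $N$ bounding all indices that occur), $U<V$ iff $(\sum_ik_i,k_N,\ldots,k_2,k_1)<(\sum_il_i,l_N,\ldots,l_2,l_1)$ lexicographically. $\bar f$ is the leading (largest) monomial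 of $f$, and $|U|$ is the total degree of $U$. Every Schubert polynomial is monic (leading coefficient $1$), and $u\mapsto\overline{\partial_u\mathfrak{S}_{w_0^n}}$ is a bijection from $S_n$ to $\{x_1^{k_1}\cdots x_{n-1}^{k_{n-1}}\mid k_i+i\le n\}$. For a monomial $W$, $\mathfrak{S}_W$ denotes the unique Schubert polynomial with leading monomial $W$. The $\mathfrak{S}_W$, over all monomials $W$ in $x_1,x_2,\ldots$, form a $\mathbb{Z}$-basis of $\mathbb{Z}[x_1,x_2,\ldots]$, and $c^W_{U,V}\in\mathbb{Z}$ are the structure constants defined by $\mathfrak{S}_U\mathfrak{S}_V=\sum_Wc^W_{U,V}\mathfrak{S}_W$. For a polynomial $f$, $c_W(f)$ is the coefficient of the monomial $W$ in $f$. *)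

theory Defs
  imports "HOL-Library.Poly_Mapping" "HOL-Combinatorics.Permutations"
begin

(* Indices start at 0: the variable x_(i+1) is "xvar i", S_n acts on {..<n}, and s_(i+1) is the
   transposition of i and Suc i. Monomials are written additively, so the product UV is U + V. *)

type_synonym monom = "nat \<Rightarrow>\<^sub>0 nat"
type_synonym mpoly = "monom \<Rightarrow>\<^sub>0 int"

abbreviation mcoeff :: "monom \<Rightarrow> mpoly \<Rightarrow> int" where
  "mcoeff W f \<equiv> Poly_Mapping.lookup f W"

definition xvar :: "nat \<Rightarrow> mpoly" where
  "xvar i = Poly_Mapping.single (Poly_Mapping.single i 1) 1"

(* As the transposition is an involution, precomposing exponents with it renames the variables. *)
definition swap_vars :: "nat \<Rightarrow> mpoly \<Rightarrow> mpoly" where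
  "swap_vars i = Poly_Mapping.map_key (Poly_Mapping.map_key (transpose i (Suc i)))"

definition div_diff :: "nat \<Rightarrow> mpoly \<Rightarrow> mpoly" where
  "div_diff i f = (THE g. (xvar i - xvar (Suc i)) * g = f - swap_vars i f)"

definition word_perm :: "nat list \<Rightarrow> nat \<Rightarrow> nat" where
  "word_perm a = foldr (\<lambda>i p. transpose i (Suc i) \<circ> p) a id"

definition reduced_word :: "nat \<Rightarrow> (nat \<Rightarrow> nat) \<Rightarrow> nat list \<Rightarrow> bool" where
  "reduced_word n u a \<longleftrightarrow>
     is_arg_min length (\<lambda>b. set b \<subseteq> {i. Suc i < n} \<and> word_perm b = u) a"

definition div_diff_perm :: "nat \<Rightarrow> (nat \<Rightarrow> nat) \<Rightarrow> mpoly \<Rightarrow> mpoly" where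
  "div_diff_perm n u = foldr div_diff (SOME a. reduced_word n u a)"

definition schubert_w0 :: "nat \<Rightarrow> mpoly" where
  "schubert_w0 n = (\<Prod>i<n. xvar i ^ (n - 1 - i))"

definition is_schubert :: "mpoly \<Rightarrow> bool" where
  "is_schubert f \<longleftrightarrow> (\<exists>n\<ge>2. \<exists>u. u permutes {..<n} \<and> f = div_diff_perm n u (schubert_w0 n))"

definition mdeg :: "monom \<Rightarrow> nat" where
  "mdeg U = (\<Sum>i\<in>Poly_Mapping.keys U. Poly_Mapping.lookup U i)"

(* Degree first; ties are decided by the largest index at which the exponents differ. *)
definition monom_less :: "monom \<Rightarrow> monom \<Rightarrow> bool" (infix "\<prec>\<^sub>m" 50) where
  "U \<prec>\<^sub>m V \<longleftrightarrow> mdeg U < mdeg V \<or>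
     (mdeg U = mdeg V \<and>
      (\<exists>i. Poly_Mapping.lookup U i < Poly_Mapping.lookup V i \<and>
           (\<forall>j>i. Poly_Mapping.lookup U j = Poly_Mapping.lookup V j)))"

definition monom_le :: "monom \<Rightarrow> monom \<Rightarrow> bool" (infix "\<preceq>\<^sub>m" 50) where
  "U \<preceq>\<^sub>m V \<longleftrightarrow> U \<prec>\<^sub>m V \<or> U = V"

definition lead_monom :: "mpoly \<Rightarrow> monom" where
  "lead_monom f = (THE U. U \<in> Poly_Mapping.keys f \<and> (\<forall>V\<in>Poly_Mapping.keys f. V \<preceq>\<^sub>m U))"

definition schubert :: "monom \<Rightarrow> mpoly" where
  "schubert W = (THE f. is_schubert f \<and> lead_monom f = W)"

(* The finitely supported family W \<mapsto> c^W_{U,V} of coordinates in the basis of Schubert polynomials. *)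
definition schubert_expansion :: "monom \<Rightarrow> monom \<Rightarrow> (monom \<Rightarrow>\<^sub>0 int)" where
  "schubert_expansion U V = (THE c :: monom \<Rightarrow>\<^sub>0 int.
     schubert U * schubert V =
       (\<Sum>W\<in>Poly_Mapping.keys c. of_int (Poly_Mapping.lookup c W) * schubert W))"

definition struct_const :: "monom \<Rightarrow> monom \<Rightarrow> monom \<Rightarrow> int" where
  "struct_const U V W = Poly_Mapping.lookup (schubert_expansion U V) W"

(* The index sets of the sums over smaller monomials are finite, so these sums are genuine. *)
lemma finite_monoms_below:
  "finite {W. mdeg W = mdeg M \<and> W \<prec>\<^sub>m M}"
proof -
  let ?l = "Poly_Mapping.lookup :: monom \<Rightarrow> nat \<Rightarrow> nat"
  obtain N where N: "\<And>j. j \<ge> N \<Longrightarrow> ?l M j = 0"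
  proof -
    have "finite (Poly_Mapping.keys M)" by simp
    then obtain N where "\<forall>j\<in>Poly_Mapping.keys M. j < N"
      using finite_nat_set_iff_bounded by blast
    then have "?l M j = 0" if "j \<ge> N" for j
      using that by (metis in_keys_iff not_le)
    then show ?thesis using that by blast
  qed
  let ?F = "{f::nat \<Rightarrow> nat. \<forall>j. (j \<in> {..<N} \<longrightarrow> f j \<in> {..mdeg M}) \<and> (j \<notin> {..<N} \<longrightarrow> f j = 0)}"
  have fin: "finite ?F" by (rule finite_set_of_finite_funs) auto
  have "?l ` {W. mdeg W = mdeg M \<and> W \<prec>\<^sub>m M} \<subseteq> ?F"
  proof (clarify, intro allI conjI impI)
    fix W j assume d: "mdeg W = mdeg M" and lt: "W \<prec>\<^sub>m M"
    show "?l W j \<in> {..mdeg M}"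
    proof (cases "j \<in> Poly_Mapping.keys W")
      case True
      then have "?l W j \<le> mdeg W"
        unfolding mdeg_def by (intro member_le_sum) auto
      then show ?thesis using d by simp
    next
      case False
      then show ?thesis by (simp add: in_keys_iff)
    qed
    from lt d obtain i where i: "?l W i < ?l M i" "\<forall>j>i. ?l W j = ?l M j"
      unfolding monom_less_def by auto
    have "i < N" using i(1) N[of i] by (metis not_le not_less0)
    assume "j \<notin> {..<N}"
    then show "?l W j = 0" using i(2) \<open>i < N\<close> N[of j] by simp
  qed
  then have "finite (?l ` {W. mdeg W = mdeg M \<and> W \<prec>\<^sub>m M})"
    using fin finite_subset by blast
  then show ?thesis
    by (rule finite_imageD) (simp add: inj_on_def poly_mapping_eqI)
qed

lemma finite_monoms_between:
  assumes "mdeg W = mdeg M"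
  shows "finite {Z. W \<prec>\<^sub>m Z \<and> Z \<preceq>\<^sub>m M}"
proof (rule finite_subset)
  show "{Z. W \<prec>\<^sub>m Z \<and> Z \<preceq>\<^sub>m M} \<subseteq> insert M {Z. mdeg Z = mdeg M \<and> Z \<prec>\<^sub>m M}"
    using assms by (auto simp: monom_le_def monom_less_def)
  show "finite (insert M {Z. mdeg Z = mdeg M \<and> Z \<prec>\<^sub>m M})"
    using finite_monoms_below by simp
qed

end

theory Submission
  imports Defs
begin

text \<open>
  A Schubert polynomial is reached from the staircase monomial by divided differences along a
  descending path of Lehmer codes, where step \<open>i\<close> turns \<open>(c\<^sub>i, c\<^sub>i\<^sub>+\<^sub>1)\<close> with \<open>c\<^sub>i > c\<^sub>i\<^sub>+\<^sub>1\<close> into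
  \<open>(c\<^sub>i\<^sub>+\<^sub>1, c\<^sub>i - 1)\<close>. By the commutation and braid relations of divided differences the result
  depends only on the final code. Every code \<open>c\<close> below the staircase can be reached by steps \<open>i\<close> at
  which \<open>c\<^sub>i\<close> is as large as the staircase allows; such steps control the leading monomial, so the
  polynomial with code \<open>c\<close> is homogeneous and monic with leading exponents \<open>c\<close>. Hence Schubert
  polynomials are unitriangular with respect to monomials, leading monomials multiply, and the
  structure constants are computed by back substitution.
\<close>

subsection \<open>Divided differences\<close>

abbreviation expo :: "monom \<Rightarrow> nat \<Rightarrow> nat" where
  "expo \<equiv> Poly_Mapping.lookup"

lemma frag_of_mult: "frag_of a * frag_of b = frag_of (a + b :: 'a::monoid_add)"
  by (simp add: mult_single)

lemma frag_of_power_single: "frag_of (Poly_Mapping.single i 1 :: monom) ^ k = frag_of (Poly_Mapping.single i k)"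
proof (induction k)
  case (Suc k)
  then show ?case
    by (simp add: frag_of_mult flip: single_add)
qed (simp flip: single_one)

text \<open>Integer polynomials form the free abelian group on the monomials, with
  \<open>frag_of\<close> as basis, so an identity additive on both sides only has to be checked on
  monomials.\<close>

lemma mpoly_induct [case_names zero monom diff]:
  fixes f :: mpoly
  assumes "P 0" "\<And>M. P (frag_of M)" "\<And>f g. P f \<Longrightarrow> P g \<Longrightarrow> P (f - g)"
  shows "P f"
  using frag_induction[of f UNIV P] assms by blast

definition swap_monom :: "nat \<Rightarrow> monom \<Rightarrow> monom" where
  "swap_monom i = Poly_Mapping.map_key (transpose i (Suc i))"

lemma lookup_swap_monom: "expo (swap_monom i M) k = expo M (transpose i (Suc i) k)"
  by (simp add: swap_monom_def map_key.rep_eq)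

lemma swap_monom_involutory [simp]: "swap_monom i (swap_monom i M) = M"
  by (rule poly_mapping_eqI) (simp add: lookup_swap_monom)

lemma inj_swap_monom: "inj (swap_monom i)"
  by (rule inj_on_inverseI[of _ "swap_monom i"]) simp

lemma swap_monom_add: "swap_monom i (M + N) = swap_monom i M + swap_monom i N"
  by (rule poly_mapping_eqI) (simp add: lookup_swap_monom lookup_add)

lemma lookup_swap_vars: "mcoeff M (swap_vars i f) = mcoeff (swap_monom i M) f"
  using inj_swap_monom by (simp add: swap_vars_def map_key.rep_eq swap_monom_def[abs_def])

lemma swap_vars_monom [simp]: "swap_vars i (frag_of M) = frag_of (swap_monom i M)"
  by (rule poly_mapping_eqI) (auto simp: lookup_swap_vars lookup_single when_def)

lemma swap_vars_zero [simp]: "swap_vars i 0 = 0"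
  and swap_vars_diff: "swap_vars i (f - g) = swap_vars i f - swap_vars i g"
  by (rule poly_mapping_eqI; simp add: lookup_swap_vars lookup_minus)+

lemma swap_vars_mult: "swap_vars i (f * g) = swap_vars i f * swap_vars i g"
proof (induction f rule: mpoly_induct)
  case (monom M)
  show ?case
    by (induction g rule: mpoly_induct)
      (simp_all add: frag_of_mult swap_monom_add right_diff_distrib swap_vars_diff)
qed (simp_all add: left_diff_distrib swap_vars_diff)

lemma xvar_eq: "xvar i = frag_of (Poly_Mapping.single i 1)"
  by (simp add: xvar_def)

lemma xvar_inject [simp]: "xvar i = xvar j \<longleftrightarrow> i = j"
proof -
  have "xvar i = xvar j \<longleftrightarrow> Poly_Mapping.single i (1::nat) = Poly_Mapping.single j 1"
    unfolding xvar_eq by (rule frag_of_eq)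
  also have "\<dots> \<longleftrightarrow> i = j"
    by (metis keys_single singleton_inject zero_neq_one)
  finally show ?thesis .
qed

lemma swap_vars_xvar: "swap_vars i (xvar j) = xvar (transpose i (Suc i) j)"
proof -
  have "swap_monom i (Poly_Mapping.single j 1) = Poly_Mapping.single (transpose i (Suc i) j) 1"
    by (rule poly_mapping_eqI) (auto simp: lookup_swap_monom lookup_single when_def transpose_def)
  then show ?thesis
    by (simp only: xvar_eq swap_vars_monom)
qed

section \<open>Quotients for monomials and their linear extension\<close>

definition set_expos :: "nat \<Rightarrow> nat \<Rightarrow> nat \<Rightarrow> monom \<Rightarrow> monom" where
  "set_expos i p q M = Poly_Mapping.update i p (Poly_Mapping.update (Suc i) q M)"

lemma lookup_set_expos:
  "expo (set_expos i p q M) = (expo M)(i := p, Suc i := q)"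
  by (auto simp: set_expos_def lookup_update)

lemma monom_split:
  "(frag_of (set_expos i p q M) :: mpoly) = frag_of (set_expos i 0 0 M) * (xvar i ^ p * xvar (Suc i) ^ q)"
proof -
  have "set_expos i p q M =
      set_expos i 0 0 M + (Poly_Mapping.single i p + Poly_Mapping.single (Suc i) q)"
    by (rule poly_mapping_eqI) (auto simp: lookup_set_expos lookup_add lookup_single when_def)
  then show ?thesis
    by (simp only: xvar_eq frag_of_power_single frag_of_mult)
qed

text \<open>With x, y the two variables, this is (x^a y^b - x^b y^a)/(x - y) as a geometric sum; a <
  b is treated by antisymmetry, and a = b gives the empty sum.\<close>

definition div_diff_monom :: "nat \<Rightarrow> monom \<Rightarrow> mpoly" where
  "div_diff_monom i M = (let a = expo M i; b = expo M (Suc i) in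
     if b \<le> a then \<Sum>t<a - b. frag_of (set_expos i (b + t) (a - 1 - t) M)
     else - (\<Sum>t<b - a. frag_of (set_expos i (a + t) (b - 1 - t) M)))"

text \<open>Once the factor (x y)^b and all other variables are pulled out, what remains is the
  factorization of x^d - y^d with d = a - b.\<close>

lemma div_diff_monom_aux:
  assumes "b \<le> a"
  shows "(xvar i - xvar (Suc i)) * (\<Sum>t<a - b. frag_of (set_expos i (b + t) (a - 1 - t) M))
      = frag_of (set_expos i a b M) - frag_of (set_expos i b a M)"
proof -
  let ?x = "xvar i" and ?y = "xvar (Suc i)" and ?R = "frag_of (set_expos i 0 0 M) :: mpoly"
  obtain d where a: "a = b + d"
    using assms le_iff_add by blast
  have "(\<Sum>t<a - b. frag_of (set_expos i (b + t) (a - 1 - t) M))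
      = (\<Sum>t<d. ?R * (?x ^ b * ?y ^ b) * (?y ^ (d - Suc t) * ?x ^ t))"
  proof (rule sum.cong)
    fix t assume "t \<in> {..<d}"
    then have "a - 1 - t = b + (d - Suc t)"
      using a by auto
    then show "frag_of (set_expos i (b + t) (a - 1 - t) M)
        = ?R * (?x ^ b * ?y ^ b) * (?y ^ (d - Suc t) * ?x ^ t)"
      by (simp only: monom_split[of i "b + t"] power_add mult_ac)
  qed (simp add: a)
  also have "\<dots> = ?R * (?x ^ b * ?y ^ b) * (\<Sum>t<d. ?y ^ (d - Suc t) * ?x ^ t)"
    by (simp add: sum_distrib_left)
  finally have "(?x - ?y) * (\<Sum>t<a - b. frag_of (set_expos i (b + t) (a - 1 - t) M))
      = ?R * (?x ^ b * ?y ^ b) * ((?x - ?y) * (\<Sum>t<d. ?y ^ (d - Suc t) * ?x ^ t))"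
    by (simp add: mult_ac)
  also have "\<dots> = ?R * (?x ^ b * ?y ^ b) * (?x ^ d - ?y ^ d)"
    by (simp only: power_diff_sumr2)
  also have "\<dots> = ?R * (?x ^ a * ?y ^ b) - ?R * (?x ^ b * ?y ^ a)"
    by (simp add: a power_add algebra_simps)
  finally show ?thesis
    by (simp only: monom_split[of i a b] monom_split[of i b a])
qed

lemma div_diff_monom:
  "(xvar i - xvar (Suc i)) * div_diff_monom i M = frag_of M - frag_of (swap_monom i M)"
proof -
  let ?a = "expo M i" and ?b = "expo M (Suc i)"
  have M: "set_expos i ?a ?b M = M" and s: "set_expos i ?b ?a M = swap_monom i M"
    by (rule poly_mapping_eqI;
        auto simp: lookup_set_expos lookup_swap_monom transpose_def)+
  show ?thesis
  proof (cases "?b \<le> ?a")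
    case True
    then show ?thesis
      using div_diff_monom_aux[OF True, of i M] by (simp add: div_diff_monom_def Let_def M s)
  next
    case False
    then have "?a \<le> ?b" by simp
    then show ?thesis
      using div_diff_monom_aux[OF \<open>?a \<le> ?b\<close>, of i M] False
      by (simp add: div_diff_monom_def Let_def M s)
  qed
qed

text \<open>The polynomial ring has no zero divisors, so the quotient is unique and the
  \<open>THE\<close> in \<open>div_diff\<close> picks any quotient that is exhibited.\<close>

lemma div_diff_eqI:
  assumes "(xvar i - xvar (Suc i)) * g = f - swap_vars i f"
  shows "div_diff i f = g"
  unfolding div_diff_def
proof (rule the_equality)
  show "(xvar i - xvar (Suc i)) * g = f - swap_vars i f" by (fact assms)
next
  fix h assume "(xvar i - xvar (Suc i)) * h = f - swap_vars i f"
  then have "(xvar i - xvar (Suc i)) * h = (xvar i - xvar (Suc i)) * g"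
    using assms by simp
  then show "h = g"
    by simp
qed

lemma div_diff_extend:
  "(xvar i - xvar (Suc i)) * frag_extend (div_diff_monom i) f = f - swap_vars i f"
proof (induction f rule: mpoly_induct)
  case (monom M)
  then show ?case by (simp add: div_diff_monom)
next
  case (diff f g)
  then show ?case
    by (simp only: frag_extend_diff right_diff_distrib[of "_ - _"] swap_vars_diff) simp
qed simp

lemma div_diff_eq_extend: "div_diff i f = frag_extend (div_diff_monom i) f"
  by (rule div_diff_eqI) (rule div_diff_extend)

lemma div_diff_mult: "(xvar i - xvar (Suc i)) * div_diff i f = f - swap_vars i f"
  unfolding div_diff_eq_extend by (rule div_diff_extend)

lemma swap_vars_involutory [simp]: "swap_vars i (swap_vars i f) = f"
  by (rule poly_mapping_eqI) (simp add: lookup_swap_vars)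

text \<open>The swap negates both the numerator and the denominator.\<close>

lemma swap_vars_div_diff [simp]: "swap_vars i (div_diff i f) = div_diff i f"
proof -
  let ?d = "xvar i - xvar (Suc i)"
  have "swap_vars i (?d * div_diff i f) = swap_vars i (f - swap_vars i f)"
    by (simp add: div_diff_mult)
  then have "- ?d * swap_vars i (div_diff i f) = - (f - swap_vars i f)"
    by (simp add: swap_vars_mult swap_vars_diff swap_vars_xvar)
  also have "\<dots> = - (?d * div_diff i f)"
    by (simp only: div_diff_mult)
  finally have "?d * swap_vars i (div_diff i f) = ?d * div_diff i f"
    by (metis minus_mult_left neg_equal_iff_equal)
  then show ?thesis by simp
qed

section \<open>Commutation and braid relations\<close>

lemma swap_vars_commute:
  assumes "Suc i < j"
  shows "swap_vars i (swap_vars j f) = swap_vars j (swap_vars i f)"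
proof (rule poly_mapping_eqI)
  have "swap_monom j (swap_monom i M) = swap_monom i (swap_monom j M)" for M
    by (rule poly_mapping_eqI) (use assms in \<open>auto simp: lookup_swap_monom transpose_def\<close>)
  then show "mcoeff M (swap_vars i (swap_vars j f)) = mcoeff M (swap_vars j (swap_vars i f))" for M
    by (simp add: lookup_swap_vars)
qed

lemma swap_vars_braid:
  "swap_vars i (swap_vars (Suc i) (swap_vars i f)) = swap_vars (Suc i) (swap_vars i (swap_vars (Suc i) f))"
proof (rule poly_mapping_eqI)
  have "swap_monom i (swap_monom (Suc i) (swap_monom i M)) =
      swap_monom (Suc i) (swap_monom i (swap_monom (Suc i) M))" for M
    by (rule poly_mapping_eqI) (auto simp: lookup_swap_monom transpose_def)
  then show "mcoeff M (swap_vars i (swap_vars (Suc i) (swap_vars i f))) =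
      mcoeff M (swap_vars (Suc i) (swap_vars i (swap_vars (Suc i) f)))" for M
    by (simp add: lookup_swap_vars)
qed

text \<open>For distant indices the swap at i fixes \<open>xvar j - xvar (Suc j)\<close>, so both
  denominators clear independently. Since the swaps commute, the right side is symmetric in i and
  j.\<close>

lemma div_diff_mult2:
  assumes "Suc i < j \<or> Suc j < i"
  shows "(xvar i - xvar (Suc i)) * ((xvar j - xvar (Suc j)) * div_diff i (div_diff j f))
      = f - swap_vars j f - swap_vars i f + swap_vars i (swap_vars j f)"
proof -
  let ?d = "\<lambda>i. xvar i - xvar (Suc i)"
  have d: "swap_vars i (?d j) = ?d j"
    using assms by (auto simp: swap_vars_diff swap_vars_xvar)
  have "?d i * (?d j * div_diff i (div_diff j f))
      = ?d j * div_diff j f - swap_vars i (?d j) * swap_vars i (div_diff j f)"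
    by (simp only: mult.left_commute[of "?d i"] div_diff_mult d right_diff_distrib[of "?d j"])
  also have "\<dots> = f - swap_vars j f - swap_vars i (f - swap_vars j f)"
    by (simp only: div_diff_mult flip: swap_vars_mult)
  finally show ?thesis
    by (simp add: swap_vars_diff)
qed

lemma div_diff_commute:
  assumes "Suc i < j \<or> Suc j < i"
  shows "div_diff i (div_diff j f) = div_diff j (div_diff i f)"
proof -
  let ?d = "\<lambda>i. xvar i - xvar (Suc i)"
  have sw: "swap_vars i (swap_vars j f) = swap_vars j (swap_vars i f)"
    using assms swap_vars_commute by metis
  have "?d i * (?d j * div_diff i (div_diff j f)) = f - swap_vars j f - swap_vars i f + swap_vars i (swap_vars j f)"
    using assms by (rule div_diff_mult2)
  also have "\<dots> = f - swap_vars i f - swap_vars j f + swap_vars j (swap_vars i f)"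
    by (simp add: sw)
  also have "\<dots> = ?d j * (?d i * div_diff j (div_diff i f))"
    using assms by (intro div_diff_mult2[symmetric]) auto
  finally have "?d i * (?d j * div_diff i (div_diff j f)) = ?d j * (?d i * div_diff j (div_diff i f))" .
  then have "(?d i * ?d j) * div_diff i (div_diff j f) = (?d i * ?d j) * div_diff j (div_diff i f)"
    by (simp only: mult_ac)
  moreover have "?d i * ?d j \<noteq> 0"
    by simp
  ultimately show ?thesis
    using mult_left_cancel by blast
qed

text \<open>Multiplied by the Vandermonde product of the three variables, either side becomes the
  alternating sum of f over their six permutations; the product then cancels.\<close>

lemma div_diff_braid:
  "div_diff i (div_diff (Suc i) (div_diff i f)) = div_diff (Suc i) (div_diff i (div_diff (Suc i) f))"
proof -
  define j where "j = Suc i"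
  let ?x = "xvar i" and ?y = "xvar j" and ?z = "xvar (Suc j)"
  let ?s = "swap_vars i" and ?t = "swap_vars j"
  have v: "?s ?x = ?y" "?s ?y = ?x" "?s ?z = ?z" "?t ?x = ?x" "?t ?y = ?z" "?t ?z = ?y"
    by (simp_all add: swap_vars_xvar j_def)
  note di = div_diff_mult[of i, folded j_def] and dj = div_diff_mult[of j]
  \<comment> \<open>Applying a swap to an equation with cleared denominator permutes the linear
    factor; these four rules track where each factor goes.\<close>
  have si: "(?x - ?z) * ?s g = ?s h" if "(?y - ?z) * g = h" for g h
    using arg_cong[OF that, of ?s] by (simp add: swap_vars_mult swap_vars_diff v)
  have sj: "(?x - ?z) * ?t g = ?t h" if "(?x - ?y) * g = h" for g h
    using arg_cong[OF that, of ?t] by (simp add: swap_vars_mult swap_vars_diff v)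
  have si': "(?y - ?z) * ?s g = ?s h" if "(?x - ?z) * g = h" for g h
    using arg_cong[OF that, of ?s] by (simp add: swap_vars_mult swap_vars_diff v)
  have sj': "(?x - ?y) * ?t g = ?t h" if "(?x - ?z) * g = h" for g h
    using arg_cong[OF that, of ?t] by (simp add: swap_vars_mult swap_vars_diff v)
  let ?D = "(?x - ?y) * ((?y - ?z) * (?x - ?z))"
  let ?alt = "f - ?s f - ?t f + ?t (?s f) + ?s (?t f) - ?s (?t (?s f))"
  have "?D * div_diff i (div_diff j (div_diff i f)) = ?alt"
  proof -
    define a b where "a = div_diff i f" and "b = div_diff j a"
    have "?D * div_diff i b = (?x - ?z) * ((?y - ?z) * b) - (?y - ?z) * ((?x - ?z) * ?s b)"
      using arg_cong[OF di[of b], of "\<lambda>h. ((?y - ?z) * (?x - ?z)) * h"] by (simp only: algebra_simps)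
    also have "\<dots> = (?x - ?z) * (a - ?t a) - (?y - ?z) * (a - ?s (?t a))"
      using dj[of a] si[OF dj[of a]] by (simp add: a_def b_def swap_vars_diff)
    also have "\<dots> = (?x - ?y) * a - (?x - ?z) * ?t a + (?y - ?z) * ?s (?t a)"
      by (simp add: algebra_simps)
    also have "\<dots> = ?alt"
      using di[of f] sj[OF di[of f]] si'[OF sj[OF di[of f]]] by (simp add: a_def swap_vars_diff)
    finally show ?thesis by (simp add: a_def b_def)
  qed
  moreover have "?D * div_diff j (div_diff i (div_diff j f)) = ?alt"
  proof -
    define a b where "a = div_diff j f" and "b = div_diff i a"
    have "?D * div_diff j b = (?x - ?z) * ((?x - ?y) * b) - (?x - ?y) * ((?x - ?z) * ?t b)"
      using arg_cong[OF dj[of b], of "\<lambda>h. ((?x - ?y) * (?x - ?z)) * h"] by (simp only: algebra_simps)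
    also have "\<dots> = (?x - ?z) * (a - ?s a) - (?x - ?y) * (a - ?t (?s a))"
      using di[of a] sj[OF di[of a]] by (simp add: a_def b_def swap_vars_diff)
    also have "\<dots> = (?y - ?z) * a - (?x - ?z) * ?s a + (?x - ?y) * ?t (?s a)"
      by (simp add: algebra_simps)
    \<comment> \<open>The longest word arises here as t s t; the braid relation of the swaps turns
      it into s t s.\<close>
    also have "\<dots> = ?alt"
      using dj[of f] si[OF dj[of f]] sj'[OF si[OF dj[of f]]] swap_vars_braid[of i f]
      by (simp add: a_def swap_vars_diff j_def)
    finally show ?thesis by (simp add: a_def b_def)
  qed
  ultimately have "?D * div_diff i (div_diff j (div_diff i f)) = ?D * div_diff j (div_diff i (div_diff j f))"
    by simp
  moreover have "?D \<noteq> 0"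
    by (simp add: j_def)
  ultimately show ?thesis
    unfolding j_def using mult_left_cancel by blast
qed

section \<open>Degree, support and leading monomial of a divided difference\<close>

lemma mdeg_add: "mdeg (M + N) = mdeg M + mdeg N"
  unfolding mdeg_def by (rule setsum_keys_plus_distrib[where f = "\<lambda>_ n. n"]) simp_all

lemma mdeg_single: "mdeg (Poly_Mapping.single i k) = k"
  by (simp add: mdeg_def)

lemma mdeg_set_expos: "mdeg (set_expos i p q M) + expo M i + expo M (Suc i) = mdeg M + p + q"
proof -
  have *: "mdeg N = mdeg (set_expos i 0 0 N) + expo N i + expo N (Suc i)" for N
  proof -
    have "N = set_expos i 0 0 N + (Poly_Mapping.single i (expo N i) + Poly_Mapping.single (Suc i) (expo N (Suc i)))"
      by (rule poly_mapping_eqI) (auto simp: lookup_set_expos lookup_add lookup_single when_def)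
    from arg_cong[OF this, of mdeg] show ?thesis
      by (simp only: mdeg_add mdeg_single)
  qed
  have "set_expos i 0 0 (set_expos i p q M) = set_expos i 0 0 M"
    by (rule poly_mapping_eqI) (auto simp: lookup_set_expos)
  then show ?thesis
    using *[of M] *[of "set_expos i p q M"] by (simp add: lookup_set_expos)
qed

text \<open>The strict bounds by the larger old exponent keep supports under the staircase and
  control the leading monomial.\<close>

lemma keys_div_diff_monom:
  assumes "K \<in> Poly_Mapping.keys (div_diff_monom i M)"
  obtains p q where "K = set_expos i p q M" "p + q + 1 = expo M i + expo M (Suc i)"
    "p < max (expo M i) (expo M (Suc i))" "q < max (expo M i) (expo M (Suc i))"
proof (cases "expo M (Suc i) \<le> expo M i")
  case True
  then have "K \<in> Poly_Mapping.keys (\<Sum>t<expo M i - expo M (Suc i).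
      frag_of (set_expos i (expo M (Suc i) + t) (expo M i - 1 - t) M))"
    using assms by (simp add: div_diff_monom_def Let_def)
  from subsetD[OF keys_sum this] obtain t where "t < expo M i - expo M (Suc i)"
    "K = set_expos i (expo M (Suc i) + t) (expo M i - 1 - t) M"
    by (auto simp del: One_nat_def)
  then show ?thesis
    by (intro that[of "expo M (Suc i) + t" "expo M i - 1 - t"]) auto
next
  case False
  then have "K \<in> Poly_Mapping.keys (\<Sum>t<expo M (Suc i) - expo M i.
      frag_of (set_expos i (expo M i + t) (expo M (Suc i) - 1 - t) M))"
    using assms by (simp add: div_diff_monom_def Let_def)
  from subsetD[OF keys_sum this] obtain t where "t < expo M (Suc i) - expo M i"
    "K = set_expos i (expo M i + t) (expo M (Suc i) - 1 - t) M"
    by (auto simp del: One_nat_def)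
  then show ?thesis
    by (intro that[of "expo M i + t" "expo M (Suc i) - 1 - t"]) auto
qed

text \<open>This is the summand t = 0. It carries the highest power of \<open>xvar (Suc i)\<close>,
  so it is the largest monomial of the sum.\<close>

lemma mcoeff_div_diff_monom:
  assumes "expo M (Suc i) < expo M i"
  shows "mcoeff (set_expos i (expo M (Suc i)) (expo M i - 1) M) (div_diff_monom i M) = 1"
proof -
  let ?a = "expo M i" and ?b = "expo M (Suc i)"
  have inj: "set_expos i (?b + t) q M = set_expos i ?b q' M \<Longrightarrow> t = 0" for t q q'
    by (drule arg_cong[of _ _ "\<lambda>N. expo N i"]) (simp add: lookup_set_expos)
  have "mcoeff (set_expos i ?b (?a - 1) M) (div_diff_monom i M) =
     (\<Sum>t<?a - ?b. mcoeff (set_expos i ?b (?a - 1) M) (frag_of (set_expos i (?b + t) (?a - 1 - t) M)))"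
    using assms by (simp add: div_diff_monom_def Let_def lookup_sum)
  also have "\<dots> = (\<Sum>t<?a - ?b. if t = 0 then 1 else 0)"
    by (intro sum.cong) (auto simp: lookup_single when_def dest: inj inj[OF sym])
  also have "\<dots> = 1"
    using assms by simp
  finally show ?thesis .
qed

lemma keys_div_diff:
  assumes "K \<in> Poly_Mapping.keys (div_diff i f)"
  obtains M where "M \<in> Poly_Mapping.keys f" "K \<in> Poly_Mapping.keys (div_diff_monom i M)"
  using assms keys_frag_extend[of "div_diff_monom i" f] by (auto simp: div_diff_eq_extend)

lemma mcoeff_div_diff:
  "mcoeff K (div_diff i f) = (\<Sum>M\<in>Poly_Mapping.keys f. mcoeff M f * mcoeff K (div_diff_monom i M))"
  by (simp add: div_diff_eq_extend frag_extend_def lookup_sum)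

definition monic_leading :: "monom \<Rightarrow> mpoly \<Rightarrow> bool" where
  "monic_leading M f \<longleftrightarrow>
     mcoeff M f = 1 \<and> (\<forall>N\<in>Poly_Mapping.keys f. N \<preceq>\<^sub>m M \<and> mdeg N = mdeg M)"

lemma monom_lessI:
  assumes "mdeg N = mdeg M" "expo N r < expo M r" "\<And>k. r < k \<Longrightarrow> expo N k = expo M k"
  shows "N \<prec>\<^sub>m M"
  using assms by (auto simp: monom_less_def)

lemma monom_lessE:
  assumes "N \<prec>\<^sub>m M" "mdeg N = mdeg M"
  obtains r where "expo N r < expo M r" "\<And>k. r < k \<Longrightarrow> expo N k = expo M k"
  using assms by (auto simp: monom_less_def)

lemma monom_less_irrefl [simp]: "\<not> M \<prec>\<^sub>m M"
  by (simp add: monom_less_def)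

text \<open>The exponent q of \<open>xvar (Suc j)\<close> in the result is at most A - 1. It equals
  A - 1 only for terms from an N with exponent A at j, and such a term has the exponent of N at
  \<open>Suc j\<close> as its exponent at j. The comparison with the new leading monomial thus
  reduces to that of N with M.\<close>

lemma monic_leading_div_diff:
  assumes lead: "monic_leading M f"
    and A: "expo M j = A"
    and bound: "\<And>N. N \<in> Poly_Mapping.keys f \<Longrightarrow> expo N j \<le> A \<and> expo N (Suc j) < A"
  shows "monic_leading (set_expos j (expo M (Suc j)) (A - 1) M) (div_diff j f)"
proof -
  let ?M' = "set_expos j (expo M (Suc j)) (A - 1) M"
  let ?b = "expo M (Suc j)"
  have M: "M \<in> Poly_Mapping.keys f"
    using lead by (simp add: monic_leading_def in_keys_iff)
  have b: "?b < A"
    using bound[OF M] by simp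
  have less: "mdeg K = mdeg ?M' \<and> (K \<prec>\<^sub>m ?M' \<or> N = M \<and> K = ?M')"
    if N: "N \<in> Poly_Mapping.keys f" and K: "K \<in> Poly_Mapping.keys (div_diff_monom j N)" for N K
  proof -
    obtain p q where K: "K = set_expos j p q N"
      and pq: "p + q + 1 = expo N j + expo N (Suc j)"
        "p < max (expo N j) (expo N (Suc j))" "q < max (expo N j) (expo N (Suc j))"
      using K by (rule keys_div_diff_monom)
    have NA: "expo N j \<le> A" "expo N (Suc j) < A" and deg: "mdeg N = mdeg M"
      using bound[OF N] lead N by (auto simp: monic_leading_def)
    have degK: "mdeg K = mdeg ?M'"
      using mdeg_set_expos[of j p q N] mdeg_set_expos[of j ?b "A - 1" M] pq(1) deg b
      by (simp add: K A)
    consider "N = M" | "N \<prec>\<^sub>m M"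
      using lead N by (auto simp: monic_leading_def monom_le_def)
    then have "K \<prec>\<^sub>m ?M' \<or> N = M \<and> K = ?M'"
    proof cases
      case 1
      show ?thesis
      proof (cases "q < A - 1")
        case True
        then have "K \<prec>\<^sub>m ?M'"
          using degK 1 by (intro monom_lessI[of _ _ "Suc j"]) (auto simp: K lookup_set_expos)
        then show ?thesis ..
      next
        case False
        then have "q = A - 1" "p = ?b"
          using pq NA b 1 A by auto
        then show ?thesis
          using 1 by (simp add: K)
      qed
    next
      case 2
      obtain r where r: "expo N r < expo M r" "\<And>k. r < k \<Longrightarrow> expo N k = expo M k"
        using 2 deg by (rule monom_lessE) blast
      \<comment> \<open>r is the highest position where N and M differ; it is compared with j and
        \<open>Suc j\<close>, the only positions that the divided difference alters.\<close>
      consider "r > Suc j" | "r = Suc j" | "r = j" | "r < j"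
        by linarith
      then have "K \<prec>\<^sub>m ?M'"
      proof cases
        case 1
        then show ?thesis
          using degK r by (intro monom_lessI[of _ _ r]) (auto simp: K lookup_set_expos)
      next
        case 2
        show ?thesis
        proof (cases "q < A - 1")
          case True
          then show ?thesis
            using degK r 2 by (intro monom_lessI[of _ _ "Suc j"]) (auto simp: K lookup_set_expos)
        next
          case False
          then have "q = A - 1" "p < ?b"
            using pq NA r(1) 2 by auto
          then show ?thesis
            using degK r 2 by (intro monom_lessI[of _ _ j]) (auto simp: K lookup_set_expos)
        qed
      next
        case 3
        \<comment> \<open>Both exponents of N are now below A, which excludes q = A - 1.\<close>
        then have "expo N (Suc j) = ?b" "expo N j < A"
          using r A by auto
        then have "q < A - 1"
          using pq b by auto
        then show ?thesis
          using degK r 3 by (intro monom_lessI[of _ _ "Suc j"]) (auto simp: K lookup_set_expos)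
      next
        case 4
        then have N': "expo N (Suc j) = ?b" "expo N j = A"
          using r A by auto
        show ?thesis
        proof (cases "q < A - 1")
          case True
          then show ?thesis
            using degK r 4 by (intro monom_lessI[of _ _ "Suc j"]) (auto simp: K lookup_set_expos)
        next
          case False
          then have "q = A - 1" "p = ?b"
            using pq N' b by auto
          then show ?thesis
            using degK r 4 by (intro monom_lessI[of _ _ r]) (auto simp: K lookup_set_expos)
        qed
      qed
      then show ?thesis ..
    qed
    with degK show ?thesis by blast
  qed
  \<comment> \<open>By \<open>less\<close>, M alone contributes to the coefficient of
    \<open>?M'\<close>.\<close>
  have "mcoeff N f * mcoeff ?M' (div_diff_monom j N) = 0" if "N \<in> Poly_Mapping.keys f" "N \<noteq> M" for N
    using less[OF that(1), of ?M'] that(2) by (auto simp: in_keys_iff)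
  then have "(\<Sum>N\<in>Poly_Mapping.keys f - {M}. mcoeff N f * mcoeff ?M' (div_diff_monom j N)) = 0"
    by (intro sum.neutral) blast
  then have "mcoeff ?M' (div_diff j f) = mcoeff M f * mcoeff ?M' (div_diff_monom j M)"
    by (simp only: mcoeff_div_diff sum.remove[OF finite_keys M] add_0_right)
  also have "\<dots> = 1"
    using lead mcoeff_div_diff_monom[of M j] b by (simp add: A monic_leading_def)
  finally show ?thesis
    unfolding monic_leading_def monom_le_def using less by (metis keys_div_diff)
qed

subsection \<open>Schubert polynomials indexed by codes\<close>

text \<open>The largest Lehmer code for n. Truncated subtraction makes it 0 from n - 1 on, so a code
  below it is finitely supported.\<close>

definition staircase :: "nat \<Rightarrow> nat \<Rightarrow> nat" where
  "staircase n j = n - 1 - j"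

definition stair_monom :: "nat \<Rightarrow> monom" where
  "stair_monom n = (\<Sum>i<n. Poly_Mapping.single i (n - 1 - i))"

lemma lookup_stair_monom: "expo (stair_monom n) = staircase n"
proof
  fix j
  have "expo (stair_monom n) j = (\<Sum>i<n. if i = j then n - 1 - i else 0)"
    by (simp add: stair_monom_def lookup_sum lookup_single when_def)
  then show "expo (stair_monom n) j = staircase n j"
    by (simp add: staircase_def)
qed

lemma schubert_w0_eq: "schubert_w0 n = frag_of (stair_monom n)"
proof -
  have "(\<Prod>i\<in>I. xvar i ^ k i) = frag_of (\<Sum>i\<in>I. Poly_Mapping.single i (k i))" if "finite I" for I k
    using that
  proof induction
    case empty
    show ?case by (simp flip: single_one)
  next
    case (insert i I)
    then show ?case
      by (simp only: prod.insert[OF insert.hyps] sum.insert[OF insert.hyps])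
        (simp only: xvar_eq frag_of_power_single frag_of_mult)
  qed
  then show ?thesis
    by (simp add: schubert_w0_def stair_monom_def)
qed

text \<open>On Lehmer codes, c_i > c_(i+1) marks a descent of w at i, and this is the passage from w
  to w s_i.\<close>

definition code_down :: "nat \<Rightarrow> (nat \<Rightarrow> nat) \<Rightarrow> nat \<Rightarrow> nat" where
  "code_down i c = c(i := c (Suc i), Suc i := c i - 1)"

definition code_up :: "nat \<Rightarrow> (nat \<Rightarrow> nat) \<Rightarrow> nat \<Rightarrow> nat" where
  "code_up i c = c(i := c (Suc i) + 1, Suc i := c i)"

text \<open>A relation rather than a function of the code, since different paths can lead to the
  same code; that they yield the same polynomial is \<open>schub_unique\<close>.\<close>

inductive schub :: "nat \<Rightarrow> (nat \<Rightarrow> nat) \<Rightarrow> mpoly \<Rightarrow> bool" for n where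
  stair: "schub n (staircase n) (schubert_w0 n)"
| down: "schub n c f \<Longrightarrow> c (Suc i) < c i \<Longrightarrow> schub n (code_down i c) (div_diff i f)"

lemma schub_bounded: "schub n c f \<Longrightarrow> c j \<le> staircase n j"
proof (induction arbitrary: j rule: schub.induct)
  case (down c f i)
  have "c i \<le> staircase n i" "c (Suc i) \<le> staircase n (Suc i)" "c j \<le> staircase n j"
    using down.IH by blast+
  then show ?case
    using down.hyps by (auto simp: code_down_def staircase_def)
qed simp

lemma bounded_descent_less:
  assumes "\<And>j. c j \<le> staircase n j" "c (Suc i) < c i"
  shows "Suc i < n"
  using assms(1)[of i] assms(2) by (simp add: staircase_def)

text \<open>Both new exponents are smaller than the larger old one, hence at most n - 2 - i, the
  height of the staircase at i + 1.\<close>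

lemma schub_keys_bounded:
  assumes "schub n c f" "N \<in> Poly_Mapping.keys f"
  shows "expo N j \<le> staircase n j"
  using assms
proof (induction arbitrary: N j rule: schub.induct)
  case stair
  then show ?case by (simp add: schubert_w0_eq lookup_stair_monom)
next
  case (down c f i)
  have i: "Suc i < n"
    using schub_bounded[OF down.hyps(1)] down.hyps(2) by (rule bounded_descent_less)
  obtain M where M: "M \<in> Poly_Mapping.keys f" "N \<in> Poly_Mapping.keys (div_diff_monom i M)"
    using down.prems by (rule keys_div_diff)
  obtain p q where N: "N = set_expos i p q M"
    and "p < max (expo M i) (expo M (Suc i))" "q < max (expo M i) (expo M (Suc i))"
    using M(2) by (rule keys_div_diff_monom)
  then show ?case
    using down.IH[OF M(1), of i] down.IH[OF M(1), of "Suc i"] down.IH[OF M(1), of j] i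
    by (auto simp: lookup_set_expos staircase_def)
qed

text \<open>The number of steps from the staircase down to a code below it. For the code of
  \<open>inv u\<close> it turns out to be the least length of a word for u.\<close>

definition code_codim :: "nat \<Rightarrow> (nat \<Rightarrow> nat) \<Rightarrow> nat" where
  "code_codim n c = (\<Sum>j<n. staircase n j - c j)"

lemma code_down_up [simp]: "code_down i (code_up i c) = c"
  by (auto simp: code_down_def code_up_def)

lemma code_up_down: "c (Suc i) < c i \<Longrightarrow> code_up i (code_down i c) = c"
  by (auto simp: code_down_def code_up_def)

lemma code_codim_up:
  assumes "Suc i < n" "c i \<le> c (Suc i)" "c i \<le> staircase n (Suc i)" "c (Suc i) < staircase n i"
    "c (Suc i) \<le> staircase n (Suc i)"
  shows "code_codim n c = Suc (code_codim n (code_up i c))"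
proof -
  have "code_codim n d = (staircase n i - d i) + (staircase n (Suc i) - d (Suc i))
      + (\<Sum>j\<in>{..<n} - {i, Suc i}. staircase n j - d j)" for d
  proof -
    have "{..<n} = {i, Suc i} \<union> ({..<n} - {i, Suc i})"
      using assms(1) by auto
    then have "code_codim n d = (\<Sum>j\<in>{i, Suc i} \<union> ({..<n} - {i, Suc i}). staircase n j - d j)"
      by (simp add: code_codim_def)
    also have "\<dots> = (\<Sum>j\<in>{i, Suc i}. staircase n j - d j)
        + (\<Sum>j\<in>{..<n} - {i, Suc i}. staircase n j - d j)"
      by (intro sum.union_disjoint) auto
    finally show ?thesis by simp
  qed
  note this[of c] this[of "code_up i c"]
  moreover have "(\<Sum>j\<in>{..<n} - {i, Suc i}. staircase n j - code_up i c j)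
      = (\<Sum>j\<in>{..<n} - {i, Suc i}. staircase n j - c j)"
    by (intro sum.cong) (auto simp: code_up_def)
  ultimately show ?thesis
    using assms by (simp add: code_up_def)
qed

text \<open>The last step is taken at the largest j where c lies below the staircase. One step up,
  entry j has the full height n - 1 - j, and all exponents obey the staircase, so
  \<open>monic_leading_div_diff\<close> applies with A = \<open>staircase n j\<close>.\<close>

lemma schub_exists:
  assumes "\<And>j. c j \<le> staircase n j"
  shows "\<exists>f M. schub n c f \<and> expo M = c \<and> monic_leading M f"
  using assms
proof (induction "code_codim n c" arbitrary: c rule: less_induct)
  case less
  show ?case
  proof (cases "c = staircase n")
    case True
    have "monic_leading (stair_monom n) (schubert_w0 n)"
      by (simp add: monic_leading_def schubert_w0_eq monom_le_def)
    then show ?thesis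
      using True schub.stair lookup_stair_monom by blast
  next
    case False
    let ?J = "{j. c j < staircase n j}"
    have "\<exists>j. c j < staircase n j"
      using False less.prems by (metis antisym_conv2 ext)
    moreover have fin: "finite ?J"
      by (rule finite_subset[of _ "{..<n}"]) (auto simp: staircase_def)
    ultimately obtain j where j: "j = Max ?J" "c j < staircase n j"
      using Max_in[of ?J] by auto
    have "c (Suc j) = staircase n (Suc j)"
      using less.prems[of "Suc j"] Max_ge[OF fin, of "Suc j"] j(1) by fastforce
    then have cj: "c (Suc j) + 1 = staircase n j" and jn: "Suc j < n"
      using j(2) by (auto simp: staircase_def)
    let ?d = "code_up j c"
    have d: "?d k \<le> staircase n k" for k
      using less.prems[of k] cj j(2) by (auto simp: code_up_def staircase_def)
    have "code_codim n c = Suc (code_codim n ?d)"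
      using jn cj j(2) less.prems[of "Suc j"] by (intro code_codim_up) (auto simp: staircase_def)
    then obtain f M where f: "schub n ?d f" "expo M = ?d" "monic_leading M f"
      using less.hyps[of ?d] d by auto
    have desc: "?d (Suc j) < ?d j"
      using j(2) cj by (simp add: code_up_def)
    have dj: "expo M j = staircase n j"
      using cj by (simp add: f(2) code_up_def)
    let ?M' = "set_expos j (expo M (Suc j)) (staircase n j - 1) M"
    have "schub n c (div_diff j f)"
      using schub.down[OF f(1) desc] by simp
    moreover have "expo ?M' = c"
      using cj by (auto simp: lookup_set_expos f(2) code_up_def fun_eq_iff)
    moreover have "monic_leading ?M' (div_diff j f)"
    proof (rule monic_leading_div_diff[OF f(3) dj])
      fix N assume "N \<in> Poly_Mapping.keys f"
      then show "expo N j \<le> staircase n j \<and> expo N (Suc j) < staircase n j"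
        using schub_keys_bounded[OF f(1), of N j] schub_keys_bounded[OF f(1), of N "Suc j"] jn
        by (simp add: staircase_def)
    qed
    ultimately show ?thesis by blast
  qed
qed

lemma schub_downI:
  assumes "schub n (code_up i c) f" "c i \<le> c (Suc i)"
  shows "schub n c (div_diff i f)"
proof -
  have "schub n (code_down i (code_up i c)) (div_diff i f)"
    using assms by (intro schub.down) (auto simp: code_up_def)
  then show ?thesis by simp
qed

text \<open>Inversion of the last step, read upwards: the previous code is recovered from c as
  \<open>code_up i c\<close> and is one step closer to the staircase.\<close>

lemma schub_cases_up:
  assumes "schub n c f"
  obtains "c = staircase n" "f = schubert_w0 n"
  | i g where "schub n (code_up i c) g" "c i \<le> c (Suc i)" "f = div_diff i g" "Suc i < n"
    "\<And>j. code_up i c j \<le> staircase n j" "code_codim n c = Suc (code_codim n (code_up i c))"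
  using assms
proof cases
  case stair
  then show ?thesis using that(1) by blast
next
  case (down d g i)
  have d: "code_up i c = d"
    using down by (simp add: code_up_down)
  have b: "d j \<le> staircase n j" for j
    using down(3) by (rule schub_bounded)
  have i: "Suc i < n"
    using b down(4) by (rule bounded_descent_less)
  have c: "c i = d (Suc i)" "c (Suc i) = d i - 1"
    by (simp_all add: down code_down_def)
  show ?thesis
  proof (rule that(2)[of i g])
    show "code_codim n c = Suc (code_codim n (code_up i c))"
      using b[of i] b[of "Suc i"] i down(4) c
      by (intro code_codim_up) (auto simp: staircase_def)
  qed (use down d b i c in auto)
qed

text \<open>The argument of Matsumoto's theorem: two last steps \<open>i\<close> and \<open>j\<close> are completed to a full
  commutation or braid relation starting from a common code \<open>y\<close>.\<close>

lemma schub_unique: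
  assumes "schub n c f" "schub n c g"
  shows "f = g"
  using assms
proof (induction "code_codim n c" arbitrary: c f g rule: less_induct)
  case less
  \<comment> \<open>The two last steps enter symmetrically, so i <= j may be assumed.\<close>
  have main: "f = g"
    if f: "schub n c f" "schub n (code_up i c) f'" "c i \<le> c (Suc i)" "f = div_diff i f'" "Suc i < n"
      "\<And>j. code_up i c j \<le> staircase n j" "code_codim n c = Suc (code_codim n (code_up i c))"
      and g: "schub n c g" "schub n (code_up j c) g'" "c j \<le> c (Suc j)" "g = div_diff j g'" "Suc j < n"
      "\<And>k. code_up j c k \<le> staircase n k" "code_codim n c = Suc (code_codim n (code_up j c))"
      and "i \<le> j" for i j f g f' g'
  proof -
    have IHf: "f' = h" if "schub n (code_up i c) h" for h
      using less.hyps[OF _ f(2) that] f(7) by simp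
    have IHg: "g' = h" if "schub n (code_up j c) h" for h
      using less.hyps[OF _ g(2) that] g(7) by simp
    have b: "c k \<le> staircase n k" for k
      using f(1) by (rule schub_bounded)
    note fi = f(6)[of i] f(6)[of "Suc i"] and gj = g(6)[of j] g(6)[of "Suc j"]
    consider "i = j" | "Suc i < j" | "j = Suc i"
      using \<open>i \<le> j\<close> by linarith
    then show ?thesis
    proof cases
      case 1
      then show ?thesis
        using IHf g(2) f(4) g(4) by blast
    next
      case 2
      let ?y = "code_up i (code_up j c)"
      have y: "?y = code_up j (code_up i c)"
        using 2 by (auto simp: code_up_def)
      have "?y k \<le> staircase n k" for k
        using f(6)[of k] g(6)[of k] 2 by (auto simp: code_up_def split: if_splits)
      \<comment> \<open>\<open>schub_exists\<close> reaches \<open>?y\<close> without reference to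
        \<open>f'\<close> and \<open>g'\<close>; the induction hypothesis then identifies these two
        with the continuations of h.\<close>
      then obtain h where h: "schub n ?y h"
        using schub_exists by blast
      have "schub n (code_up j c) (div_diff i h)"
        by (rule schub_downI[OF h]) (use f(3) 2 in \<open>auto simp: code_up_def\<close>)
      then have g': "g = div_diff j (div_diff i h)"
        using IHg g(4) by simp
      have "schub n (code_up i c) (div_diff j h)"
        by (rule schub_downI[OF h[unfolded y]]) (use g(3) 2 in \<open>auto simp: code_up_def\<close>)
      then have "f = div_diff i (div_diff j h)"
        using IHf f(4) by simp
      with g' show ?thesis
        using 2 by (simp add: div_diff_commute)
    next
      case 3
      \<comment> \<open>If c has the entries a, b, d at i, i + 1, i + 2, then a <= b <= d, and both
        threefold ascents end in d + 2, b + 1, a.\<close>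
      let ?y = "code_up i (code_up j (code_up i c))"
      have y: "?y = code_up j (code_up i (code_up j c))"
        using 3 by (auto simp: code_up_def)
      have "?y k \<le> staircase n k" for k
        using b[of k] fi gj f(3) g(3) f(5) g(5) 3 b[of i] b[of j] b[of "Suc j"]
        by (auto simp: code_up_def staircase_def)
      then obtain h where h: "schub n ?y h"
        using schub_exists by blast
      have 1: "schub n (code_up j (code_up i c)) (div_diff i h)"
        by (rule schub_downI[OF h]) (use f(3) g(3) 3 in \<open>auto simp: code_up_def\<close>)
      have "schub n (code_up i c) (div_diff j (div_diff i h))"
        by (rule schub_downI[OF 1]) (use f(3) g(3) 3 in \<open>auto simp: code_up_def\<close>)
      then have f': "f = div_diff i (div_diff j (div_diff i h))"
        using IHf f(4) by simp
      have 2: "schub n (code_up i (code_up j c)) (div_diff j h)"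
        by (rule schub_downI[OF h[unfolded y]]) (use f(3) g(3) 3 in \<open>auto simp: code_up_def\<close>)
      have "schub n (code_up j c) (div_diff i (div_diff j h))"
        by (rule schub_downI[OF 2]) (use f(3) g(3) 3 in \<open>auto simp: code_up_def\<close>)
      then have "g = div_diff j (div_diff i (div_diff j h))"
        using IHg g(4) by simp
      with f' show ?thesis
        using 3 div_diff_braid by simp
    qed
  qed
  have codim: "code_codim n (staircase n) = 0"
    by (simp add: code_codim_def)
  show ?case
    using less.prems(1)
  proof (cases rule: schub_cases_up)
    case 1
    show ?thesis
      using less.prems(2) by (cases rule: schub_cases_up) (use 1 codim in auto)
  next
    case (2 i f')
    note f = 2
    show ?thesis
      using less.prems(2)
    proof (cases rule: schub_cases_up)
      case 1
      then show ?thesis using f codim by auto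
    next
      case (2 j g')
      show ?thesis
      proof (cases "i \<le> j")
        case True
        show ?thesis
          by (rule main[OF less.prems(1) f less.prems(2) 2 True])
      next
        case False
        then have "j \<le> i" by simp
        show ?thesis
          by (rule main[OF less.prems(2) 2 less.prems(1) f \<open>j \<le> i\<close>, symmetric])
      qed
    qed
  qed
qed

section \<open>Independence of n\<close>

lemma div_diff_frag_of:
  assumes "expo M i = Suc (expo M (Suc i))"
  shows "div_diff i (frag_of M) = frag_of (set_expos i (expo M (Suc i)) (expo M (Suc i)) M)"
  using assms by (simp add: div_diff_eq_extend div_diff_monom_def Let_def)

text \<open>The positive exponents n, n - 1, ..., 1 of the larger staircase are lowered one after
  the other. At each step the two exponents involved differ by exactly one, so a monomial goes to a
  monomial.\<close>

lemma schub_staircase_Suc: "schub (Suc n) (staircase n) (schubert_w0 n)"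
proof -
  let ?c = "\<lambda>k j. if j < k then n - 1 - j else n - j"
  have "\<exists>M. expo M = ?c k \<and> schub (Suc n) (?c k) (frag_of M)" if "k \<le> n" for k
    using that
  proof (induction k)
    case 0
    have c: "staircase (Suc n) = ?c 0"
      by (auto simp: staircase_def)
    show ?case
      using schub.stair[of "Suc n"] lookup_stair_monom[of "Suc n"]
      unfolding schubert_w0_eq c by blast
  next
    case (Suc k)
    then obtain M where M: "expo M = ?c k" "schub (Suc n) (?c k) (frag_of M)"
      by auto
    have k: "k < n"
      using Suc.prems by simp
    have c: "code_down k (?c k) = ?c (Suc k)"
      using k by (auto simp: code_down_def fun_eq_iff)
    have "schub (Suc n) (code_down k (?c k)) (div_diff k (frag_of M))"
      using M(2) k by (intro schub.down) auto
    moreover have "div_diff k (frag_of M) = frag_of (set_expos k (n - Suc k) (n - Suc k) M)"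
      using div_diff_frag_of[of M k] k by (simp add: M(1) Suc_diff_Suc)
    moreover have "expo (set_expos k (n - Suc k) (n - Suc k) M) = ?c (Suc k)"
      using k by (auto simp: lookup_set_expos M(1) fun_eq_iff)
    ultimately show ?case
      unfolding c by metis
  qed
  from this[of n] obtain M where M: "expo M = ?c n" "schub (Suc n) (?c n) (frag_of M)"
    by auto
  have c: "?c n = staircase n"
    by (auto simp: staircase_def)
  then have "M = stair_monom n"
    using M(1) by (simp add: poly_mapping_eq_iff lookup_stair_monom)
  then show ?thesis
    using M(2) unfolding c schubert_w0_eq by simp
qed

lemma schub_Suc: "schub n c f \<Longrightarrow> schub (Suc n) c f"
  by (induction rule: schub.induct) (auto intro: schub_staircase_Suc schub.down)

lemma schub_mono:
  assumes "m \<le> n" "schub m c f"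
  shows "schub n c f"
  using assms by (induction n rule: dec_induct) (auto intro: schub_Suc)

subsection \<open>Codes of permutations and reduced words\<close>

text \<open>Non-inversions, because composing with \<open>w\<^sub>0\<close> reverses the values: \<open>perm_code n (inv u)\<close> is the
  Lehmer code of \<open>w\<^sub>0 \<circ> inv u\<close>, the permutation that indexes the Schubert polynomial of \<open>u\<close>.\<close>

definition perm_code :: "nat \<Rightarrow> (nat \<Rightarrow> nat) \<Rightarrow> nat \<Rightarrow> nat" where
  "perm_code n p j = card {k. j < k \<and> k < n \<and> p j < p k}"

lemma perm_code_bounded: "perm_code n p j \<le> staircase n j"
proof -
  have "perm_code n p j \<le> card {j<..<n}"
    unfolding perm_code_def by (rule card_mono) auto
  then show ?thesis
    by (simp add: staircase_def)
qed

lemma perm_code_id: "perm_code n id = staircase n"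
proof
  fix j
  have "{k. j < k \<and> k < n \<and> id j < id k} = {j<..<n}"
    by auto
  then show "perm_code n id j = staircase n j"
    by (simp add: perm_code_def staircase_def)
qed

text \<open>Exchanging the values at i and i + 1 exchanges the two counts, except that the pair (i,
  i + 1) itself is no longer counted; this is the entry lowered by one.\<close>

lemma perm_code_ascent:
  assumes i: "Suc i < n" and p: "p i < p (Suc i)"
  shows "perm_code n (p \<circ> transpose i (Suc i)) = code_down i (perm_code n p)"
    and "perm_code n p (Suc i) < perm_code n p i"
proof -
  let ?s = "transpose i (Suc i)" and ?S = "\<lambda>p j. {k. j < k \<and> k < n \<and> p j < p k}"
  have ins: "?S p i = insert (Suc i) (?S (p \<circ> ?s) (Suc i))"
    using i p by (auto simp: transpose_def Suc_le_eq elim: Suc_lessE)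
  have fin: "finite (?S p j)" for p j
    by (rule finite_subset[of _ "{..<n}"]) auto
  have ci: "perm_code n p i = Suc (perm_code n (p \<circ> ?s) (Suc i))"
    unfolding perm_code_def ins using fin by (subst card_insert_disjoint) auto
  have "?S (p \<circ> ?s) i = ?S p (Suc i)"
    using p by (auto simp: transpose_def Suc_le_eq dest: Suc_lessD)
  then have cSi: "perm_code n (p \<circ> ?s) i = perm_code n p (Suc i)"
    by (simp only: perm_code_def)
  have "perm_code n p (Suc i) \<le> perm_code n (p \<circ> ?s) (Suc i)"
    unfolding perm_code_def using p
    by (intro card_mono fin) (auto simp: transpose_def)
  then show "perm_code n p (Suc i) < perm_code n p i"
    using ci by simp
  \<comment> \<open>For any other j, the positions i and i + 1 lie on the same side of j, so the
    transposition matches the two counted sets.\<close>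
  have "perm_code n (p \<circ> ?s) j = perm_code n p j" if j: "j \<noteq> i" "j \<noteq> Suc i" for j
  proof -
    have "bij_betw ?s (?S (p \<circ> ?s) j) (?S p j)"
      by (rule bij_betw_byWitness[where f' = ?s])
        (use i j in \<open>auto simp: transpose_def\<close>)
    then show ?thesis
      unfolding perm_code_def by (rule bij_betw_same_card)
  qed
  then show "perm_code n (p \<circ> ?s) = code_down i (perm_code n p)"
    using ci cSi by (auto simp: code_down_def)
qed

lemma perm_code_descent:
  assumes i: "Suc i < n" and p: "p (Suc i) < p i"
  shows "perm_code n (p \<circ> transpose i (Suc i)) = code_up i (perm_code n p)"
    and "perm_code n p i \<le> perm_code n p (Suc i)"
proof -
  let ?p = "p \<circ> transpose i (Suc i)"
  have pp: "?p \<circ> transpose i (Suc i) = p"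
    by (simp add: fun_eq_iff)
  have a: "?p i < ?p (Suc i)"
    using p by simp
  note asc = perm_code_ascent[where p = ?p, OF i a, unfolded pp]
  show "perm_code n ?p = code_up i (perm_code n p)"
    by (simp only: asc(1) code_up_down[OF asc(2)])
  show "perm_code n p i \<le> perm_code n p (Suc i)"
    using asc(2) unfolding asc(1) by (simp add: code_down_def)
qed

lemma code_codim_down:
  assumes "\<And>j. c j \<le> staircase n j" "c (Suc i) < c i"
  shows "code_codim n (code_down i c) = Suc (code_codim n c)"
proof -
  have "Suc i < n"
    using assms by (rule bounded_descent_less)
  then show ?thesis
    using code_codim_up[of i n "code_down i c"] assms(1)[of i] assms(1)[of "Suc i"] assms(2)
    by (simp add: code_up_down) (auto simp: code_down_def staircase_def)
qed

lemma code_codim_perm_ascent: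
  assumes "Suc i < n" "p i < p (Suc i)"
  shows "code_codim n (perm_code n (p \<circ> transpose i (Suc i))) = Suc (code_codim n (perm_code n p))"
  using assms perm_code_ascent perm_code_bounded code_codim_down by metis

lemma code_codim_perm_descent:
  assumes "Suc i < n" "p (Suc i) < p i"
  shows "code_codim n (perm_code n p) = Suc (code_codim n (perm_code n (p \<circ> transpose i (Suc i))))"
  using code_codim_perm_ascent[of i n "p \<circ> transpose i (Suc i)"] assms by (simp add: o_assoc[symmetric])

section \<open>Words and reduced words\<close>

lemma word_perm_simps [simp]:
  "word_perm [] = id" "word_perm (i # a) = transpose i (Suc i) \<circ> word_perm a"
  by (simp_all add: word_perm_def)

lemma word_perm_permutes:
  assumes "set a \<subseteq> {i. Suc i < n}"
  shows "word_perm a permutes {..<n}"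
  using assms
proof (induction a)
  case (Cons i a)
  then show ?case
    unfolding word_perm_simps by (intro permutes_compose permutes_swap_id) auto
qed (simp add: permutes_id)

text \<open>A new first letter multiplies u on the left, hence its inverse on the right, where it
  acts on positions; this is why codes are taken of \<open>inv u\<close>.\<close>

lemma inv_word_perm_Cons:
  assumes "set a \<subseteq> {i. Suc i < n}"
  shows "inv (word_perm (i # a)) = inv (word_perm a) \<circ> transpose i (Suc i)"
  using word_perm_permutes[OF assms, THEN permutes_bij] by (simp add: o_inv_distrib)

text \<open>Each letter changes the codimension by plus or minus one, so it is at most the length.
  Equality forces an ascent at every letter, and then the divided differences follow a descending
  path of codes.\<close>

lemma schub_of_word:
  assumes "set a \<subseteq> {i. Suc i < n}"
  defines "c \<equiv> perm_code n (inv (word_perm a))"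
  shows "code_codim n c \<le> length a"
    and "length a \<le> code_codim n c \<Longrightarrow> schub n c (foldr div_diff a (schubert_w0 n))"
proof -
  have "code_codim n (perm_code n (inv (word_perm a))) \<le> length a \<and>
      (length a \<le> code_codim n (perm_code n (inv (word_perm a))) \<longrightarrow>
        schub n (perm_code n (inv (word_perm a))) (foldr div_diff a (schubert_w0 n)))"
    using assms(1)
  proof (induction a)
    case Nil
    show ?case
      using schub.stair[of n] by (simp add: perm_code_id perm_code_id[unfolded id_def] code_codim_def)
  next
    case (Cons i a)
    let ?p = "inv (word_perm a)"
    have a: "set a \<subseteq> {i. Suc i < n}" and i: "Suc i < n"
      using Cons.prems by auto
    define q where "q = ?p \<circ> transpose i (Suc i)"
    have eq: "inv (word_perm (i # a)) = q"
      unfolding q_def using a by (rule inv_word_perm_Cons)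
    have "inj ?p"
      using word_perm_permutes[OF a] by (intro permutes_inj[OF permutes_inv])
    then have "?p i \<noteq> ?p (Suc i)"
      by (metis inj_eq n_not_Suc_n)
    then consider "?p i < ?p (Suc i)" | "?p (Suc i) < ?p i"
      by linarith
    then show ?case
    proof cases
      case 1
      then show ?thesis
        using Cons.IH[OF a] schub.down perm_code_ascent[OF i 1, folded q_def]
          code_codim_perm_ascent[OF i 1, folded q_def]
        unfolding eq by simp
    next
      \<comment> \<open>The codimension drops and stays below the length, so the second claim is
        vacuous.\<close>
      case 2
      then show ?thesis
        using Cons.IH[OF a] code_codim_perm_descent[OF i 2, folded q_def] unfolding eq by simp
    qed
  qed
  then show "code_codim n c \<le> length a"
    "length a \<le> code_codim n c \<Longrightarrow> schub n c (foldr div_diff a (schubert_w0 n))"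
    by (simp_all add: c_def)
qed

text \<open>Bubble sort of \<open>inv u\<close>: each exchange at a descent lowers the codimension
  by one, and when no descent is left u is the identity.\<close>

lemma exists_word_of_perm:
  assumes "u permutes {..<n}"
  shows "\<exists>a. set a \<subseteq> {i. Suc i < n} \<and> word_perm a = u \<and> length a = code_codim n (perm_code n (inv u))"
  using assms
proof (induction "code_codim n (perm_code n (inv u))" arbitrary: u rule: less_induct)
  case less
  let ?p = "inv u"
  have p: "?p permutes {..<n}"
    using less.prems by (rule permutes_inv)
  show ?case
  proof (cases "\<exists>i. Suc i < n \<and> ?p (Suc i) < ?p i")
    case True
    then obtain i where i: "Suc i < n" "?p (Suc i) < ?p i"
      by blast
    let ?s = "transpose i (Suc i)"
    let ?u = "?s \<circ> u"
    have u: "?u permutes {..<n}"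
      using less.prems i by (intro permutes_compose permutes_swap_id) auto
    have inv: "inv ?u = ?p \<circ> ?s"
      using permutes_bij[OF less.prems] by (simp add: o_inv_distrib)
    note codim = code_codim_perm_descent[OF i, folded inv]
    then obtain a where a: "set a \<subseteq> {i. Suc i < n}" "word_perm a = ?u"
      "length a = code_codim n (perm_code n (inv ?u))"
      using less.hyps[of ?u] u by auto
    have "word_perm (i # a) = u"
      by (simp add: a(2) fun_eq_iff)
    then show ?thesis
      using a i codim by (intro exI[of _ "i # a"]) auto
  next
    case False
    have "?p i < ?p (Suc i)" if "Suc i < n" for i
      using False that permutes_inj[OF p] by (metis inj_eq linorder_neqE_nat n_not_Suc_n)
    then have "j < n \<Longrightarrow> j \<le> ?p j" for j
    proof (induction j)
      case (Suc j)
      then show ?case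
        by (metis Suc_leI Suc_lessD le_less_trans)
    qed simp
    then have "?p = id"
      using p by (intro permutes_natset_ge[of _ "{..<n}"]) auto
    then have "u = id"
      using less.prems by (metis inv_id permutes_inv_inv)
    then show ?thesis
      by (intro exI[of _ "[]"]) (simp add: perm_code_id code_codim_def)
  qed
qed

text \<open>A reduced word is no longer than the word of length \<open>code_codim\<close> built
  before, so \<open>schub_of_word\<close> applies. With \<open>schub_unique\<close>, the choice of
  reduced word in \<open>div_diff_perm\<close> is immaterial.\<close>

lemma schub_of_reduced_word:
  assumes u: "u permutes {..<n}" and a: "reduced_word n u a"
  shows "schub n (perm_code n (inv u)) (foldr div_diff a (schubert_w0 n))"
proof -
  obtain b where "set b \<subseteq> {i. Suc i < n}" "word_perm b = u"
    and b: "length b = code_codim n (perm_code n (inv u))"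
    using exists_word_of_perm[OF u] by blast
  then have "length a \<le> length b" "set a \<subseteq> {i. Suc i < n}" "word_perm a = u"
    using a by (auto simp: reduced_word_def is_arg_min_def)
  then show ?thesis
    using schub_of_word(2)[of a n] b by simp
qed

lemma schub_div_diff_perm:
  assumes u: "u permutes {..<n}"
  shows "schub n (perm_code n (inv u)) (div_diff_perm n u (schubert_w0 n))"
proof -
  obtain a where a: "set a \<subseteq> {i. Suc i < n}" "word_perm a = u"
    "length a = code_codim n (perm_code n (inv u))"
    using exists_word_of_perm[OF u] by blast
  have "length a \<le> length b" if "set b \<subseteq> {i. Suc i < n}" "word_perm b = u" for b
    using schub_of_word(1)[OF that(1)] that(2) a(3) by simp
  then have "reduced_word n u a"
    using a by (auto simp: reduced_word_def is_arg_min_def not_less)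
  then have "reduced_word n u (SOME a. reduced_word n u a)"
    by (rule someI)
  then show ?thesis
    unfolding div_diff_perm_def using u by (intro schub_of_reduced_word)
qed

text \<open>Each descending step of the code is matched by multiplying u on the left by the
  transposition.\<close>

lemma schub_code_is_perm_code:
  assumes "schub n c f"
  shows "\<exists>u. u permutes {..<n} \<and> perm_code n (inv u) = c"
  using assms
proof induction
  case stair
  then show ?case
    using perm_code_id permutes_id by (metis inv_id)
next
  case (down c f i)
  then obtain u where u: "u permutes {..<n}" "perm_code n (inv u) = c"
    by blast
  have i: "Suc i < n"
    using schub_bounded[OF down.hyps(1)] down.hyps(2) by (rule bounded_descent_less)
  let ?s = "transpose i (Suc i)"
  have "inv u (Suc i) \<noteq> inv u i"
    using permutes_inj[OF permutes_inv[OF u(1)]] by (metis inj_eq n_not_Suc_n)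
  \<comment> \<open>At a descent of \<open>inv u\<close> the code would satisfy c_i <= c_(i+1),
    against the hypothesis of the step.\<close>
  moreover have "\<not> inv u (Suc i) < inv u i"
    using perm_code_descent(2)[OF i] u(2) down.hyps(2) by (metis not_le)
  ultimately have "perm_code n (inv u \<circ> ?s) = code_down i c"
    using perm_code_ascent(1)[OF i] u(2) by simp
  moreover have "inv (?s \<circ> u) = inv u \<circ> ?s"
    using permutes_bij[OF u(1)] by (simp add: o_inv_distrib)
  moreover have "?s \<circ> u permutes {..<n}"
    using u(1) i by (intro permutes_compose permutes_swap_id) auto
  ultimately show ?case
    by metis
qed

lemma is_schubert_iff_schub: "is_schubert f \<longleftrightarrow> (\<exists>n c. schub n c f)"
proof
  assume "is_schubert f"
  then show "\<exists>n c. schub n c f"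
    using schub_div_diff_perm unfolding is_schubert_def by blast
next
  assume "\<exists>n c. schub n c f"
  then obtain m c where "schub m c f" by blast
  \<comment> \<open>\<open>is_schubert\<close> asks for n >= 2, so a smaller index is raised
    first.\<close>
  then have f: "schub (max 2 m) c f"
    by (rule schub_mono[rotated]) simp
  then obtain u where u: "u permutes {..<max 2 m}" "perm_code (max 2 m) (inv u) = c"
    using schub_code_is_perm_code by blast
  then have "f = div_diff_perm (max 2 m) u (schubert_w0 (max 2 m))"
    using f schub_div_diff_perm[OF u(1)] by (intro schub_unique) auto
  then show "is_schubert f"
    using u(1) unfolding is_schubert_def by (metis max.cobounded1)
qed

subsection \<open>Unitriangularity\<close>

lemma monom_less_trans:
  assumes "U \<prec>\<^sub>m V" "V \<prec>\<^sub>m W"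
  shows "U \<prec>\<^sub>m W"
proof (cases "mdeg U = mdeg V \<and> mdeg V = mdeg W")
  case True
  obtain r where r: "expo U r < expo V r" "\<And>k. r < k \<Longrightarrow> expo U k = expo V k"
    using assms(1) by (rule monom_lessE) (use True in blast)+
  obtain s where s: "expo V s < expo W s" "\<And>k. s < k \<Longrightarrow> expo V k = expo W k"
    using assms(2) by (rule monom_lessE) (use True in blast)+
  show ?thesis
  proof (rule monom_lessI[of _ _ "max r s"])
    show "expo U (max r s) < expo W (max r s)"
      using r(1) s(1) r(2)[of s] s(2)[of r] by (cases r s rule: linorder_cases) auto
  qed (use True r s in auto)
next
  case False
  then show ?thesis
    using assms by (auto simp: monom_less_def)
qed

lemma monom_less_asym: "U \<prec>\<^sub>m V \<Longrightarrow> \<not> V \<prec>\<^sub>m U"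
  using monom_less_trans monom_less_irrefl by blast

lemma monom_less_add:
  assumes "U \<prec>\<^sub>m V"
  shows "U + W \<prec>\<^sub>m V + W"
  using assms by (auto simp: monom_less_def mdeg_add lookup_add)

lemma lead_monom_eq:
  assumes "monic_leading M f"
  shows "lead_monom f = M"
  unfolding lead_monom_def
proof (rule the_equality)
  show "M \<in> Poly_Mapping.keys f \<and> (\<forall>V\<in>Poly_Mapping.keys f. V \<preceq>\<^sub>m M)"
    using assms by (simp add: monic_leading_def in_keys_iff)
next
  fix U assume "U \<in> Poly_Mapping.keys f \<and> (\<forall>V\<in>Poly_Mapping.keys f. V \<preceq>\<^sub>m U)"
  moreover have "M \<in> Poly_Mapping.keys f"
    using assms by (simp add: monic_leading_def in_keys_iff)
  ultimately show "U = M"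
    using assms monom_less_asym unfolding monic_leading_def monom_le_def by blast
qed

lemma monic_leadingE:
  assumes "monic_leading M f"
  obtains g where "f = frag_of M + g"
    "\<And>N. N \<in> Poly_Mapping.keys g \<Longrightarrow> N \<prec>\<^sub>m M \<and> mdeg N = mdeg M"
proof (rule that[of "f - frag_of M"])
  fix N assume N: "N \<in> Poly_Mapping.keys (f - frag_of M)"
  then have "N \<noteq> M"
    using assms by (auto simp: in_keys_iff lookup_minus monic_leading_def)
  with N have "N \<in> Poly_Mapping.keys f"
    by (auto simp: in_keys_iff lookup_minus lookup_single)
  then show "N \<prec>\<^sub>m M \<and> mdeg N = mdeg M"
    using assms \<open>N \<noteq> M\<close> by (auto simp: monic_leading_def monom_le_def)
qed simp

lemma monic_leadingI:
  assumes "\<And>N. N \<in> Poly_Mapping.keys g \<Longrightarrow> N \<prec>\<^sub>m M \<and> mdeg N = mdeg M"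
  shows "monic_leading M (frag_of M + g)"
proof -
  have "M \<notin> Poly_Mapping.keys g"
    using assms monom_less_irrefl by blast
  then have "mcoeff M (frag_of M + g) = 1"
    by (simp add: lookup_add in_keys_iff)
  moreover have "Poly_Mapping.keys (frag_of M + g) \<subseteq> insert M (Poly_Mapping.keys g)"
    using keys_add[of "frag_of M" g] by simp
  ultimately show ?thesis
    using assms unfolding monic_leading_def monom_le_def by blast
qed

text \<open>Once the leading terms are split off, every remaining product of monomials is strictly
  below U + V, since the order is compatible with adding exponents.\<close>

lemma monic_leading_mult:
  assumes "monic_leading U f" "monic_leading V g"
  shows "monic_leading (U + V) (f * g)"
proof -
  obtain f' where f: "f = frag_of U + f'"
    and f': "\<And>N. N \<in> Poly_Mapping.keys f' \<Longrightarrow> N \<prec>\<^sub>m U \<and> mdeg N = mdeg U"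
    using assms(1) by (rule monic_leadingE) blast
  obtain g' where g: "g = frag_of V + g'"
    and g': "\<And>N. N \<in> Poly_Mapping.keys g' \<Longrightarrow> N \<prec>\<^sub>m V \<and> mdeg N = mdeg V"
    using assms(2) by (rule monic_leadingE) blast
  have "f * g = frag_of (U + V) + (frag_of U * g' + f' * g)"
    by (simp add: f g algebra_simps frag_of_mult)
  moreover have "monic_leading (U + V) (frag_of (U + V) + (frag_of U * g' + f' * g))"
  proof (rule monic_leadingI)
    fix N assume "N \<in> Poly_Mapping.keys (frag_of U * g' + f' * g)"
    then consider "N \<in> Poly_Mapping.keys (frag_of U * g')" | "N \<in> Poly_Mapping.keys (f' * g)"
      using keys_add[of "frag_of U * g'" "f' * g"] by auto
    then show "N \<prec>\<^sub>m U + V \<and> mdeg N = mdeg (U + V)"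
    proof cases
      case 1
      then obtain K where K: "N = U + K" "K \<in> Poly_Mapping.keys g'"
        using keys_mult[of "frag_of U" g'] by auto
      then show ?thesis
        using g'[OF K(2)] monom_less_add[of K V U] by (simp add: mdeg_add add.commute)
    next
      case 2
      then obtain J K where JK: "N = J + K" "J \<in> Poly_Mapping.keys f'" "K \<in> Poly_Mapping.keys g"
        using keys_mult[of f' g] by auto
      have K: "K \<preceq>\<^sub>m V" "mdeg K = mdeg V"
        using JK(3) assms(2) by (auto simp: monic_leading_def)
      have "J + K \<prec>\<^sub>m U + K"
        using f'[OF JK(2)] monom_less_add by blast
      moreover have "U + K \<preceq>\<^sub>m U + V"
        using K(1) monom_less_add[of K V U] by (auto simp: monom_le_def add.commute)
      ultimately show ?thesis
        using JK(1) f'[OF JK(2)] K(2) monom_less_trans by (auto simp: monom_le_def mdeg_add)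
    qed
  qed
  ultimately show ?thesis by simp
qed

section \<open>Schubert polynomials indexed by leading monomials\<close>

lemma schub_monic_leading:
  assumes "schub n c f"
  shows "\<exists>M. expo M = c \<and> monic_leading M f"
  using schub_exists[of c n] schub_bounded[OF assms] schub_unique[OF assms] by blast

lemma schub_for_monom: "\<exists>n f. schub n (expo W) f \<and> monic_leading W f"
proof -
  obtain N where N: "\<And>j. j \<in> Poly_Mapping.keys W \<Longrightarrow> j < N"
    using finite_nat_set_iff_bounded[of "Poly_Mapping.keys W"] by auto
  \<comment> \<open>All variables of W have index below N, where this staircase is higher than
    \<open>mdeg W\<close>.\<close>
  let ?n = "N + mdeg W + 1"
  have "expo W j \<le> staircase ?n j" for j
  proof (cases "j \<in> Poly_Mapping.keys W")
    case True
    then have "expo W j \<le> mdeg W"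
      unfolding mdeg_def by (intro member_le_sum) auto
    then show ?thesis
      using N[OF True] by (simp add: staircase_def)
  qed (simp add: in_keys_iff)
  then show ?thesis
    using schub_exists[of "expo W"] by (metis poly_mapping_eqI)
qed

text \<open>Justifies the \<open>THE\<close> in \<open>schubert\<close>: a Schubert polynomial with
  leading monomial W has code \<open>expo W\<close>, and two of them, moved to a common n, agree by
  \<open>schub_unique\<close>.\<close>

lemma schubert_monic_leading: "monic_leading W (schubert W)"
proof -
  obtain n f where f: "schub n (expo W) f" "monic_leading W f"
    using schub_for_monom by blast
  have "schubert W = f"
    unfolding schubert_def
  proof (rule the_equality)
    show "is_schubert f \<and> lead_monom f = W"
      using f lead_monom_eq is_schubert_iff_schub by blast
  next
    fix g assume g: "is_schubert g \<and> lead_monom g = W"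
    then obtain m c where m: "schub m c g"
      using is_schubert_iff_schub by blast
    then have "c = expo W"
      using schub_monic_leading lead_monom_eq g by metis
    then have "schub (max m n) (expo W) g" "schub (max m n) (expo W) f"
      using m f(1) by (auto intro: schub_mono[rotated])
    then show "g = f"
      by (rule schub_unique)
  qed
  then show ?thesis
    using f(2) by simp
qed

text \<open>Links the scalar multiplication inside \<open>frag_extend\<close> with the product by an
  integer constant in \<open>schubert_expansion\<close>.\<close>

lemma frag_cmul_eq_of_int_mult:
  fixes f :: "'a::monoid_add \<Rightarrow>\<^sub>0 int"
  shows "frag_cmul k f = of_int k * f"
proof -
  have "of_int k = (Poly_Mapping.single 0 k :: 'a \<Rightarrow>\<^sub>0 int)"
    by (metis single_of_int of_int_eq_id id_apply)
  moreover have "frag_cmul k f = Poly_Mapping.single 0 k * f"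
  proof (rule frag_induction[of f UNIV])
    show "frag_cmul k (frag_of x) = Poly_Mapping.single 0 k * frag_of x" for x :: 'a
      by (rule poly_mapping_eqI) (simp add: mult_single lookup_single when_def)
    show "frag_cmul k (a - b) = Poly_Mapping.single 0 k * (a - b)"
      if "frag_cmul k a = Poly_Mapping.single 0 k * a" "frag_cmul k b = Poly_Mapping.single 0 k * b"
      for a b :: "'a \<Rightarrow>\<^sub>0 int"
      using that frag_cmul_distrib2[of k "a - b" b] by (simp add: right_diff_distrib)
  qed simp_all
  ultimately show ?thesis by simp
qed

section \<open>Schubert polynomials as a basis\<close>

definition lower_monoms :: "monom \<Rightarrow> monom set" where
  "lower_monoms M = {W. mdeg W = mdeg M \<and> W \<preceq>\<^sub>m M}"

lemma lower_monoms_eq: "lower_monoms M = insert M {W. mdeg W = mdeg M \<and> W \<prec>\<^sub>m M}"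
  by (auto simp: lower_monoms_def monom_le_def)

lemma lower_monoms_subset: "N \<in> lower_monoms M \<Longrightarrow> lower_monoms N \<subseteq> lower_monoms M"
  using monom_less_trans by (auto simp: lower_monoms_def monom_le_def)

definition schubert_span :: "monom \<Rightarrow> mpoly set" where
  "schubert_span M = {frag_extend schubert c |c. Poly_Mapping.keys c \<subseteq> lower_monoms M}"

lemma schubert_span_diff:
  assumes "f \<in> schubert_span M" "g \<in> schubert_span M"
  shows "f - g \<in> schubert_span M"
proof -
  obtain c d where "f = frag_extend schubert c" "g = frag_extend schubert d"
    "Poly_Mapping.keys c \<subseteq> lower_monoms M" "Poly_Mapping.keys d \<subseteq> lower_monoms M"
    using assms by (auto simp: schubert_span_def)
  then show ?thesis
    using keys_diff[of c d] unfolding schubert_span_def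
    by (intro CollectI exI[of _ "c - d"]) (auto simp: frag_extend_diff)
qed

text \<open>Induction on the finite number of smaller monomials of the same degree: the monomial is
  \<open>schubert M\<close> minus a combination of smaller ones, which lie in the span
  already.\<close>

lemma monom_in_schubert_span: "frag_of M \<in> schubert_span M"
proof (induction "card {W. mdeg W = mdeg M \<and> W \<prec>\<^sub>m M}" arbitrary: M rule: less_induct)
  case less
  have zero: "0 \<in> schubert_span M" for M
    unfolding schubert_span_def by (auto intro!: exI[of _ 0])
  have lower: "frag_of N \<in> schubert_span M" if N: "N \<prec>\<^sub>m M" "mdeg N = mdeg M" for N
  proof -
    have "{W. mdeg W = mdeg N \<and> W \<prec>\<^sub>m N} \<subset> {W. mdeg W = mdeg M \<and> W \<prec>\<^sub>m M}"
    proof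
      show "{W. mdeg W = mdeg N \<and> W \<prec>\<^sub>m N} \<subseteq> {W. mdeg W = mdeg M \<and> W \<prec>\<^sub>m M}"
        using N monom_less_trans by auto
      have "N \<in> {W. mdeg W = mdeg M \<and> W \<prec>\<^sub>m M} - {W. mdeg W = mdeg N \<and> W \<prec>\<^sub>m N}"
        using N by simp
      then show "{W. mdeg W = mdeg N \<and> W \<prec>\<^sub>m N} \<noteq> {W. mdeg W = mdeg M \<and> W \<prec>\<^sub>m M}"
        by blast
    qed
    then have "frag_of N \<in> schubert_span N"
      by (intro less.hyps psubset_card_mono finite_monoms_below)
    moreover have "lower_monoms N \<subseteq> lower_monoms M"
      using N by (intro lower_monoms_subset) (simp add: lower_monoms_def monom_le_def)
    ultimately show ?thesis
      by (auto simp: schubert_span_def)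
  qed
  obtain g where g: "schubert M = frag_of M + g"
    "\<And>N. N \<in> Poly_Mapping.keys g \<Longrightarrow> N \<prec>\<^sub>m M \<and> mdeg N = mdeg M"
    using schubert_monic_leading by (rule monic_leadingE) blast
  have "g \<in> schubert_span M"
    by (rule frag_induction[of g "Poly_Mapping.keys g"])
      (use g(2) lower zero schubert_span_diff in auto)
  moreover have "schubert M \<in> schubert_span M"
    unfolding schubert_span_def
    by (intro CollectI exI[of _ "frag_of M"]) (simp add: lower_monoms_eq)
  ultimately have "schubert M - g \<in> schubert_span M"
    by (intro schubert_span_diff)
  then show ?case
    by (simp add: g(1))
qed

lemma lower_poly_in_schubert_span:
  assumes "Poly_Mapping.keys f \<subseteq> lower_monoms M"
  shows "f \<in> schubert_span M"
proof (rule frag_induction[OF assms])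
  show "0 \<in> schubert_span M"
    unfolding schubert_span_def by (auto intro!: exI[of _ 0])
next
  fix N assume "N \<in> lower_monoms M"
  then show "frag_of N \<in> schubert_span M"
    using monom_in_schubert_span[of N] lower_monoms_subset[of N M]
    by (auto simp: schubert_span_def)
qed (rule schubert_span_diff)

lemma mcoeff_schubert_self: "mcoeff W (schubert W) = 1"
  using schubert_monic_leading by (simp add: monic_leading_def)

lemma mcoeff_schubert_eq_0:
  assumes "W \<noteq> Z" "\<not> W \<prec>\<^sub>m Z"
  shows "mcoeff W (schubert Z) = 0"
  using schubert_monic_leading[of Z] assms by (auto simp: monic_leading_def monom_le_def in_keys_iff)

lemma mcoeff_schubert_combination:
  "mcoeff K (frag_extend schubert c) =
     (\<Sum>W\<in>Poly_Mapping.keys c. Poly_Mapping.lookup c W * mcoeff K (schubert W))"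
  by (simp add: frag_extend_def lookup_sum)

text \<open>Let M be maximal in the support of c. As \<open>schubert W\<close> involves M only if M
  is at most W, the coefficient of M in the combination is that of c at M.\<close>

lemma schubert_independent:
  assumes "frag_extend schubert c = 0"
  shows "c = 0"
proof (rule ccontr)
  assume "c \<noteq> 0"
  then have "\<exists>M\<in>Poly_Mapping.keys c. \<forall>W\<in>Poly_Mapping.keys c. W \<noteq> M \<longrightarrow> \<not> M \<prec>\<^sub>m W"
    by (intro Finite_Set.bex_max_element transp_onI asymp_onI)
      (auto intro: monom_less_trans dest: monom_less_asym)
  then obtain M where M: "M \<in> Poly_Mapping.keys c"
    and max: "\<And>W. W \<in> Poly_Mapping.keys c \<Longrightarrow> W \<noteq> M \<Longrightarrow> \<not> M \<prec>\<^sub>m W"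
    by blast
  have "(\<Sum>W\<in>Poly_Mapping.keys c - {M}. Poly_Mapping.lookup c W * mcoeff M (schubert W)) = 0"
    using max by (intro sum.neutral) (auto intro: mcoeff_schubert_eq_0)
  then have "mcoeff M (frag_extend schubert c) = Poly_Mapping.lookup c M"
    by (simp only: mcoeff_schubert_combination sum.remove[OF finite_keys M]
        mcoeff_schubert_self mult_1_right add_0_right)
  then show False
    using M assms by (simp add: in_keys_iff)
qed

lemma schubert_expansion_eqI:
  assumes "schubert U * schubert V = frag_extend schubert c"
  shows "schubert_expansion U V = c"
  unfolding schubert_expansion_def frag_extend_def[symmetric] frag_cmul_eq_of_int_mult[symmetric]
proof (rule the_equality)
  show "schubert U * schubert V = frag_extend schubert c"
    by (fact assms)
next
  fix d assume "schubert U * schubert V = frag_extend schubert d"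
  then have "frag_extend schubert (d - c) = 0"
    using assms by (simp add: frag_extend_diff)
  then show "d = c"
    using schubert_independent by fastforce
qed

theorem mainTheorem4:
  fixes U V :: monom
  shows "schubert U * schubert V =
           schubert (U + V) +
           (\<Sum>W\<in>{W. mdeg W = mdeg (U + V) \<and> W \<prec>\<^sub>m U + V}. of_int (struct_const U V W) * schubert W)
       \<and> (\<forall>W. W \<prec>\<^sub>m U + V \<and> mdeg W = mdeg (U + V) \<longrightarrow>
            struct_const U V W =
              mcoeff W (schubert U * schubert V) -
              (\<Sum>Z\<in>{Z. W \<prec>\<^sub>m Z \<and> Z \<preceq>\<^sub>m U + V}. struct_const U V Z * mcoeff W (schubert Z)))"
proof -
  let ?M = "U + V" and ?P = "schubert U * schubert V" and ?c = "struct_const U V"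
  let ?B = "{W. mdeg W = mdeg ?M \<and> W \<prec>\<^sub>m ?M}"
  have lead: "monic_leading ?M ?P"
    by (intro monic_leading_mult schubert_monic_leading)
  \<comment> \<open>The product is homogeneous with leading monomial U + V, so its expansion runs
    over \<open>lower_monoms\<close> only.\<close>
  then have "Poly_Mapping.keys ?P \<subseteq> lower_monoms ?M"
    by (auto simp: monic_leading_def lower_monoms_def)
  then obtain c where c: "?P = frag_extend schubert c" "Poly_Mapping.keys c \<subseteq> lower_monoms ?M"
    using lower_poly_in_schubert_span unfolding schubert_span_def by blast
  have sc: "?c = Poly_Mapping.lookup c"
    unfolding struct_const_def[abs_def] schubert_expansion_eqI[OF c(1)] ..
  have fin: "finite (lower_monoms ?M)"
    unfolding lower_monoms_eq using finite_monoms_below by simp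
  have P: "?P = (\<Sum>W\<in>lower_monoms ?M. of_int (?c W) * schubert W)"
    unfolding c(1) frag_extend_def frag_cmul_eq_of_int_mult sc
    by (rule sum.mono_neutral_left) (use fin c(2) in \<open>auto simp: in_keys_iff\<close>)
  \<comment> \<open>Coefficients of W are compared: \<open>schubert W\<close> has coefficient 1
    there, and any other \<open>schubert Z\<close> contributes only if W is smaller than Z.\<close>
  have coeff: "mcoeff W ?P = ?c W + (\<Sum>Z\<in>{Z. W \<prec>\<^sub>m Z \<and> Z \<preceq>\<^sub>m ?M}. ?c Z * mcoeff W (schubert Z))"
    if W: "W \<in> lower_monoms ?M" for W
  proof -
    let ?A = "{Z. W \<prec>\<^sub>m Z \<and> Z \<preceq>\<^sub>m ?M}"
    have A: "?A \<subseteq> lower_monoms ?M" "W \<notin> ?A" "finite ?A"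
      using W finite_monoms_between[of W ?M]
      by (auto simp: lower_monoms_def monom_le_def monom_less_def)
    have "mcoeff W ?P = (\<Sum>Z\<in>Poly_Mapping.keys c. ?c Z * mcoeff W (schubert Z))"
      by (simp add: c(1) sc mcoeff_schubert_combination)
    also have "\<dots> = (\<Sum>Z\<in>lower_monoms ?M. ?c Z * mcoeff W (schubert Z))"
      by (rule sum.mono_neutral_left) (use fin c(2) in \<open>auto simp: sc in_keys_iff\<close>)
    also have "\<dots> = (\<Sum>Z\<in>insert W ?A. ?c Z * mcoeff W (schubert Z))"
    proof (rule sum.mono_neutral_right[OF fin])
      show "insert W ?A \<subseteq> lower_monoms ?M"
        using A W by blast
      show "\<forall>Z\<in>lower_monoms ?M - insert W ?A. ?c Z * mcoeff W (schubert Z) = 0"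
        by (auto simp: lower_monoms_def intro: mcoeff_schubert_eq_0)
    qed
    also have "\<dots> = ?c W + (\<Sum>Z\<in>?A. ?c Z * mcoeff W (schubert Z))"
      using A by (simp add: mcoeff_schubert_self)
    finally show ?thesis .
  qed
  \<comment> \<open>At the top monomial no larger Z remains, so its constant is the leading
    coefficient of the product.\<close>
  have "{Z. ?M \<prec>\<^sub>m Z \<and> Z \<preceq>\<^sub>m ?M} = {}"
    using monom_less_asym by (auto simp: monom_le_def)
  then have "mcoeff ?M ?P = ?c ?M"
    using coeff[of ?M] by (simp only: lower_monoms_eq insertI1 sum.empty add_0_right)
  then have "?c ?M = 1"
    using lead by (simp add: monic_leading_def)
  moreover have "?P = of_int (?c ?M) * schubert ?M + (\<Sum>W\<in>?B. of_int (?c W) * schubert W)"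
    unfolding P lower_monoms_eq by (rule sum.insert) (use finite_monoms_below in auto)
  ultimately have "?P = schubert ?M + (\<Sum>W\<in>?B. of_int (?c W) * schubert W)"
    by simp
  moreover have "?c W = mcoeff W ?P - (\<Sum>Z\<in>{Z. W \<prec>\<^sub>m Z \<and> Z \<preceq>\<^sub>m ?M}. ?c Z * mcoeff W (schubert Z))"
    if "W \<prec>\<^sub>m ?M \<and> mdeg W = mdeg ?M" for W
    using coeff[of W] that by (simp add: lower_monoms_eq)
  ultimately show ?thesis by blast
qed

end
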